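(* Let $T$ be the binary tree. Then $sep_{T\times T}(n)\asymp \dfrac{n}{\log n}$; that is, there are constants $0<c\le C<\infty$ such that $c\,\frac{n}{\log n}\le sep_{T\times T}(n)\le C\,\frac{n}{\log n}$ for all integers $n\ge 2$.
   Context: $T$ is the infinite rooted binary tree (every vertex has two children). $T\times T$ is the Cartesian product graph: $(u,v)$ and $(u',v')$ are adjacent iff $u=u'$ and $v\sim v'$, or $u\sim u'$ and $v=v'$. Separation: for a finite set $S$ of vertices of a graph $G$, $cut(S)$ is the minimum size of a subset $C_S\subset S$ such that the largest connected component of the subgraph of $G$ induced by $S\setminus C_S$ has fewer than $|S|/2$ vertices. For a positive integer $n$, $sep_G(n)=\sup\{cut(S): S\subset V(G),\ |S|=n\}$. *)

theory Defs
  imports Complex_Main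
begin

text \<open>
  A graph is given by its (symmetric) adjacency relation; its vertex set is the whole carrier type.
  The induced subgraph on \<open>W\<close> keeps exactly the edges with both endpoints in \<open>W\<close>.
\<close>

definition connected_components :: "('a \<Rightarrow> 'a \<Rightarrow> bool) \<Rightarrow> 'a set \<Rightarrow> 'a set set" where
  "connected_components adj W =
     W // {(x, y). x \<in> W \<and> y \<in> W \<and> (\<lambda>u v. u \<in> W \<and> v \<in> W \<and> adj u v)\<^sup>*\<^sup>* x y}"

text \<open>
  Deleting all of a nonempty \<open>S\<close> is allowed: no component remains, which counts as a largest
  component with 0 vertices. Hence the minimum below exists whenever \<open>S\<close> is finite and nonempty.
\<close>

definition separates :: "('a \<Rightarrow> 'a \<Rightarrow> bool) \<Rightarrow> 'a set \<Rightarrow> 'a set \<Rightarrow> bool" where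
  "separates adj S C \<longleftrightarrow>
     C \<subseteq> S \<and> (\<forall>K \<in> connected_components adj (S - C). real (card K) < real (card S) / 2)"

definition cut :: "('a \<Rightarrow> 'a \<Rightarrow> bool) \<Rightarrow> 'a set \<Rightarrow> nat" where
  "cut adj S = (LEAST k. \<exists>C. separates adj S C \<and> card C = k)"

text \<open>
  The supremum is taken in \<^typ>\<open>nat\<close>, where it is meaningful only for bounded sets;
  \<open>bdd_above_cut\<close> below shows that this is the case here.
\<close>

definition sep :: "('a \<Rightarrow> 'a \<Rightarrow> bool) \<Rightarrow> nat \<Rightarrow> nat" where
  "sep adj n = Sup {cut adj S |S. finite S \<and> card S = n}"

lemma separates_self: "separates adj S S"
  by (simp add: separates_def connected_components_def)

lemma cut_le_card: "cut adj S \<le> card S"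
  unfolding cut_def by (rule Least_le) (use separates_self in blast)

lemma bdd_above_cut: "bdd_above {cut adj S |S. finite S \<and> card S = n}"
  by (rule bdd_aboveI[of _ n]) (auto simp: cut_le_card)

text \<open>
  The infinite rooted binary tree: the root is \<^term>\<open>[]\<close> and the two children of \<open>u\<close>
  are \<^term>\<open>False # u\<close> and \<^term>\<open>True # u\<close>.
\<close>

definition tree_adj :: "bool list \<Rightarrow> bool list \<Rightarrow> bool" where
  "tree_adj u v \<longleftrightarrow> (\<exists>b. v = b # u) \<or> (\<exists>b. u = b # v)"

definition product_adj ::
    "('a \<Rightarrow> 'a \<Rightarrow> bool) \<Rightarrow> ('b \<Rightarrow> 'b \<Rightarrow> bool) \<Rightarrow> 'a \<times> 'b \<Rightarrow> 'a \<times> 'b \<Rightarrow> bool" where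
  "product_adj adj1 adj2 p q \<longleftrightarrow>
     (fst p = fst q \<and> adj2 (snd p) (snd q)) \<or> (adj1 (fst p) (fst q) \<and> snd p = snd q)"

end

theory Submission
  imports Defs
begin

text \<open>
  Upper bound: cutting each of the two trees at every \<open>L\<close>-th level, with \<open>L\<close> of order \<open>log n\<close>, leaves
  components inside products of two trees of depth less than \<open>L\<close>, hence of fewer than \<open>4 ^ L\<close>
  vertices. By averaging over the residue of the levels, both cuts can be chosen to contain at most
  \<open>n / L\<close> points of \<open>S\<close>.

  Lower bound: the pairs of vertices whose depths add up to \<open>k - 1\<close> or \<open>k\<close> form a butterfly network
  with about \<open>k 2 ^ k\<close> vertices. Join \<open>([], w)\<close> to \<open>(w', [])\<close>, for words \<open>w\<close>, \<open>w'\<close> of length \<open>k\<close>, by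
  the path through the pairs (suffix of \<open>w'\<close>, suffix of \<open>w\<close>). Each vertex is on \<open>2 ^ k\<close> or
  \<open>2 ^ (k + 1)\<close> of these \<open>4 ^ k\<close> paths, so deleting \<open>m\<close> vertices cuts only \<open>O(k m)\<close> vertices off one
  large component. For \<open>n\<close> between two consecutive network sizes, some vertices with depth sum
  \<open>k + 1\<close> are added, each of which is adjacent to the network.
\<close>

section \<open>Averaging, components and separation numbers\<close>

lemma exists_le_average:
  fixes f :: "'a \<Rightarrow> nat"
  assumes "finite A" "A \<noteq> {}"
  shows "\<exists>a\<in>A. card A * f a \<le> sum f A"
proof -
  obtain a where a: "a \<in> A" "f a = Min (f ` A)"
    using assms by (metis (mono_tags, lifting) Min_in finite_imageI image_iff image_is_empty)
  have "of_nat (card A) * f a \<le> sum f A"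
    by (rule sum_bounded_below) (use a assms in auto)
  then show ?thesis using a(1) by auto
qed

lemma connected_componentsE:
  assumes "K \<in> connected_components adj W"
  obtains x where "x \<in> W"
    and "K = {y \<in> W. (\<lambda>u v. u \<in> W \<and> v \<in> W \<and> adj u v)\<^sup>*\<^sup>* x y}"
  using assms unfolding connected_components_def quotient_def by auto

lemma connected_componentsI:
  assumes "x \<in> W"
  shows "{y \<in> W. (\<lambda>u v. u \<in> W \<and> v \<in> W \<and> adj u v)\<^sup>*\<^sup>* x y} \<in> connected_components adj W"
  using assms unfolding connected_components_def quotient_def by auto

lemma cut_attained:
  obtains C where "separates adj S C" "card C = cut adj S"
proof -
  have "\<exists>C. separates adj S C \<and> card C = cut adj S"
    unfolding cut_def by (rule LeastI_ex) (use separates_self in blast)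
  then show ?thesis using that by blast
qed

lemma cut_le_card_separator: "separates adj S C \<Longrightarrow> cut adj S \<le> card C"
  unfolding cut_def by (rule Least_le) blast

lemma cut_le_sep: "finite S \<Longrightarrow> cut adj S \<le> sep adj (card S)"
  unfolding sep_def by (rule cSup_upper) (use bdd_above_cut in auto)

text \<open>The infinite vertex type supplies a set of every finite size, so the supremum is not
  over the empty set.\<close>

lemma sep_le:
  fixes adj :: "'a \<Rightarrow> 'a \<Rightarrow> bool"
  assumes "infinite (UNIV :: 'a set)"
    and "\<And>S. finite S \<Longrightarrow> card S = n \<Longrightarrow> cut adj S \<le> b"
  shows "sep adj n \<le> b"
proof -
  obtain S :: "'a set" where "finite S" "card S = n"
    using infinite_arbitrarily_large[OF assms(1)] by blast
  then show ?thesis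
    unfolding sep_def by (intro cSup_least) (use assms(2) in blast)+
qed

lemma product_adj_sym:
  "product_adj tree_adj tree_adj p q \<Longrightarrow> product_adj tree_adj tree_adj q p"
  unfolding product_adj_def tree_adj_def by auto


section \<open>Upper bound\<close>

text \<open>The residue classes of \<open>g\<close> modulo \<open>L\<close> partition
  \<open>S\<close>, so some class \<open>r\<close> is at most average; \<open>s = L - r\<close>
  encodes it.\<close>

lemma exists_sparse_residue:
  fixes g :: "'a \<Rightarrow> nat"
  assumes "finite S" "0 < L"
  shows "\<exists>s. card {x \<in> S. L dvd g x + s} \<le> card S div L"
proof -
  have "(\<Sum>r<L. card {x \<in> S. g x mod L = r}) = card (\<Union>r\<in>{..<L}. {x \<in> S. g x mod L = r})"
    by (rule card_UN_disjoint[symmetric]) (use assms in auto)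
  also have "(\<Union>r\<in>{..<L}. {x \<in> S. g x mod L = r}) = S"
    using assms by auto
  finally have sum: "(\<Sum>r<L. card {x \<in> S. g x mod L = r}) = card S" .
  obtain r where r: "r < L" "L * card {x \<in> S. g x mod L = r} \<le> card S"
    using exists_le_average[of "{..<L}" "\<lambda>r. card {x \<in> S. g x mod L = r}"] assms(2) sum by auto
  have "g x mod L = r" if dvd: "L dvd g x + (L - r)" for x
  proof -
    obtain q where "g x + (L - r) = L * q" using dvd unfolding dvd_def by blast
    then have "g x + L = r + L * q" using r(1) by linarith
    then have "(g x + L) mod L = (r + L * q) mod L" by simp
    then show ?thesis using r(1) by simp
  qed
  then have "card {x \<in> S. L dvd g x + (L - r)} \<le> card {x \<in> S. g x mod L = r}"
    using assms(1) by (intro card_mono) auto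
  also have "\<dots> \<le> card S div L"
    using r(2) assms(2) by (simp add: less_eq_div_iff_mult_less_eq mult.commute)
  finally show ?thesis by blast
qed

text \<open>
  The lowest ancestor of \<open>u\<close> at a depth \<open>d\<close> with \<open>L dvd d + s\<close> (the root, if there is none).
\<close>

definition block_top :: "nat \<Rightarrow> nat \<Rightarrow> bool list \<Rightarrow> bool list" where
  "block_top L s u = drop ((length u + s) mod L) u"

text \<open>Passing to a child prepends one letter and also drops one more, unless the residue wraps
  to 0, which happens only at a cut level.\<close>

lemma block_top_adj:
  assumes "tree_adj u v" "\<not> L dvd length u + s" "\<not> L dvd length v + s"
  shows "block_top L s u = block_top L s v"
proof -
  have "block_top L s (b # x) = block_top L s x" if "\<not> L dvd length (b # x) + s" for b x
    using that by (auto simp: block_top_def mod_Suc dvd_eq_mod_eq_0 split: if_splits)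
  then show ?thesis using assms unfolding tree_adj_def by metis
qed

text \<open>A member of the fibre is \<open>t\<close> with fewer than \<open>L\<close> letters in
  front, and there are \<open>2 ^ L - 1\<close> such prefixes.\<close>

lemma block_top_fibre:
  assumes "0 < L"
  shows "finite {u. block_top L s u = t}" "card {u. block_top L s u = t} < 2 ^ L"
proof -
  define Z :: "bool list set" where "Z = {z. set z \<subseteq> UNIV \<and> length z \<le> L - 1}"
  have "finite Z" unfolding Z_def by (rule finite_lists_length_le) simp
  have "card Z = (\<Sum>i\<le>L - 1. 2 ^ i)"
    unfolding Z_def by (subst card_lists_length_le) auto
  also have "{..L - 1} = {0..<L}" using assms by auto
  finally have cZ: "card Z < 2 ^ L" by (simp add: sum_power2)
  have sub: "{u. block_top L s u = t} \<subseteq> (\<lambda>z. z @ t) ` Z"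
  proof
    fix u assume "u \<in> {u. block_top L s u = t}"
    then have "u = take ((length u + s) mod L) u @ t" by (auto simp: block_top_def)
    moreover have "(length u + s) mod L < L" using assms by simp
    then have "take ((length u + s) mod L) u \<in> Z" unfolding Z_def by auto
    ultimately show "u \<in> (\<lambda>z. z @ t) ` Z" by blast
  qed
  show "finite {u. block_top L s u = t}"
    using sub \<open>finite Z\<close> finite_surj by blast
  show "card {u. block_top L s u = t} < 2 ^ L"
    using surj_card_le[OF \<open>finite Z\<close> sub] cZ by linarith
qed

lemma cut_product_tree_le:
  assumes "finite S" "0 < L" "2 * 4 ^ L \<le> card S"
  shows "cut (product_adj tree_adj tree_adj) S \<le> 2 * (card S div L)"
proof -
  obtain s1 where s1: "card {x \<in> S. L dvd length (fst x) + s1} \<le> card S div L"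
    using exists_sparse_residue[OF assms(1,2), of "\<lambda>x. length (fst x)"] by blast
  obtain s2 where s2: "card {x \<in> S. L dvd length (snd x) + s2} \<le> card S div L"
    using exists_sparse_residue[OF assms(1,2), of "\<lambda>x. length (snd x)"] by blast
  define C where "C = {x \<in> S. L dvd length (fst x) + s1} \<union> {x \<in> S. L dvd length (snd x) + s2}"
  have "card K < 4 ^ L" if K: "K \<in> connected_components (product_adj tree_adj tree_adj) (S - C)" for K
  proof -
    obtain x where x: "K = {y \<in> S - C. (\<lambda>u v. u \<in> S - C \<and> v \<in> S - C \<and>
        product_adj tree_adj tree_adj u v)\<^sup>*\<^sup>* x y}"
      using K by (rule connected_componentsE)
    \<comment> \<open>Both block tops are constant along paths avoiding \<open>C\<close>, which
      confines \<open>K\<close> to a product of two fibres.\<close>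
    have inv: "block_top L s1 (fst y) = block_top L s1 (fst x) \<and>
        block_top L s2 (snd y) = block_top L s2 (snd x)"
      if "(\<lambda>u v. u \<in> S - C \<and> v \<in> S - C \<and> product_adj tree_adj tree_adj u v)\<^sup>*\<^sup>* x y" for y
      using that
    proof (induction rule: rtranclp_induct)
      case (step y z)
      have "block_top L s1 (fst y) = block_top L s1 (fst z)"
        using step.hyps(2) block_top_adj[of "fst y" "fst z" L s1]
        unfolding product_adj_def C_def by auto
      moreover have "block_top L s2 (snd y) = block_top L s2 (snd z)"
        using step.hyps(2) block_top_adj[of "snd y" "snd z" L s2]
        unfolding product_adj_def C_def by auto
      ultimately show ?case using step.IH by simp
    qed simp
    let ?A = "{u. block_top L s1 u = block_top L s1 (fst x)}"
    let ?B = "{u. block_top L s2 u = block_top L s2 (snd x)}"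
    have "K \<subseteq> ?A \<times> ?B"
    proof
      fix y assume "y \<in> K"
      then show "y \<in> ?A \<times> ?B" using inv[of y] unfolding x by (simp add: mem_Times_iff)
    qed
    then have "card K \<le> card ?A * card ?B"
      using card_mono[of "?A \<times> ?B" K] block_top_fibre(1)[OF assms(2)]
      by (simp add: card_cartesian_product)
    also have "\<dots> < 2 ^ L * 2 ^ L"
      using block_top_fibre(2)[OF assms(2)] by (intro mult_strict_mono) auto
    also have "\<dots> = 4 ^ L" by (simp flip: power_mult_distrib)
    finally show ?thesis .
  qed
  moreover have "C \<subseteq> S" unfolding C_def by auto
  ultimately have "separates (product_adj tree_adj tree_adj) S C"
    unfolding separates_def using assms(3) by fastforce
  then have "cut (product_adj tree_adj tree_adj) S \<le> card C" by (rule cut_le_card_separator)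
  also have "\<dots> \<le> 2 * (card S div L)"
    using s1 s2 unfolding C_def by (intro order.trans[OF card_Un_le]) linarith
  finally show ?thesis .
qed

lemma sep_product_tree_le:
  assumes "2 \<le> n"
  shows "real (sep (product_adj tree_adj tree_adj) n) \<le> 16 * (real n / ln (real n))"
proof -
  have inf: "infinite (UNIV :: (bool list \<times> bool list) set)"
    by (simp add: finite_prod infinite_UNIV_listI)
  show ?thesis
  proof (cases "n < 16")
    case True
    have "sep (product_adj tree_adj tree_adj) n \<le> n"
      using cut_le_card by (intro sep_le[OF inf]) auto
    moreover have "real n \<le> 16 * (real n / ln (real n))"
    proof -
      have "ln (real n) \<le> ln (2 ^ 4)" using True assms by (subst ln_le_cancel_iff) auto
      also have "\<dots> = 4 * ln 2" by (subst ln_realpow) auto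
      also have "\<dots> \<le> 4" using ln_le_minus_one[of "2::real"] by simp
      finally have "ln (real n) \<le> 16" by simp
      then have "real n * ln (real n) \<le> real n * 16" by (intro mult_left_mono) auto
      moreover have "0 < ln (real n)" using assms by simp
      ultimately show ?thesis by (simp add: field_simps)
    qed
    ultimately show ?thesis by linarith
  next
    case False
    \<comment> \<open>Base 16 is the square of 4: for \<open>L > 0\<close> this gives
      \<open>2 * 4 ^ L \<le> 16 ^ L \<le> n\<close>.\<close>
    obtain L where L: "16 ^ L \<le> n" "n < 16 ^ (L + 1)"
      using ex_power_ivl1[of 16 n] assms by auto
    have "L > 0" using L(2) False by (cases L) auto
    have "(2::nat) \<le> 4 ^ L" using \<open>L > 0\<close> by (cases L) auto
    then have "2 * 4 ^ L \<le> (4 ^ L * 4 ^ L :: nat)" by simp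
    also have "\<dots> = 16 ^ L" by (simp flip: power_mult_distrib)
    finally have "2 * 4 ^ L \<le> n" using L(1) by linarith
    then have "sep (product_adj tree_adj tree_adj) n \<le> 2 * (n div L)"
      using cut_product_tree_le \<open>L > 0\<close> by (intro sep_le[OF inf]) blast
    then have "real (sep (product_adj tree_adj tree_adj) n) \<le> 2 * real (n div L)" by linarith
    also have "\<dots> \<le> 2 * (real n / real L)"
      using of_nat_div_le_of_nat[of n L, where 'a = real] by (intro mult_left_mono) auto
    also have "\<dots> \<le> 16 * (real n / ln (real n))"
    proof -
      have "n \<le> 2 ^ (4 * (L + 1))" using L(2) unfolding power_mult by simp
      then have "real n \<le> 2 ^ (4 * (L + 1))" by (metis of_nat_le_iff of_nat_numeral of_nat_power)
      then have "ln (real n) \<le> ln (2 ^ (4 * (L + 1)))" using assms by (subst ln_le_cancel_iff) auto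
      also have "\<dots> = 4 * (L + 1) * ln 2" by (subst ln_realpow) auto
      also have "\<dots> \<le> real (4 * (L + 1)) * 1"
        using ln_le_minus_one[of "2::real"] by (intro mult_left_mono) auto
      also have "\<dots> \<le> 8 * real L" using \<open>L > 0\<close> by simp
      finally have "ln (real n) \<le> 8 * real L" .
      moreover have "0 < ln (real n)" using assms by simp
      ultimately show ?thesis using \<open>L > 0\<close> assms by (simp add: field_simps)
    qed
    finally show ?thesis .
  qed
qed


section \<open>Lower bound\<close>

definition words :: "nat \<Rightarrow> bool list set" where
  "words k = {w. length w = k}"

text \<open>
  Reading \<open>(u, v)\<close> with \<open>length u + length v = k\<close> as the word \<open>rev u @ v\<close> with a cursor between
  its two parts, moving the cursor one step through the level \<open>k - 1\<close> may change the bit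
  passed over: this is the butterfly network.
\<close>

definition butterfly :: "nat \<Rightarrow> (bool list \<times> bool list) set" where
  "butterfly k = {(u, v). k \<le> Suc (length u + length v) \<and> length u + length v \<le> k}"

text \<open>Even positions are followed by dropping a letter of \<open>w\<close>, odd ones by
  prepending a letter of \<open>w'\<close>, taken from its end; so the depth sum alternates between
  \<open>k\<close> and \<open>k - 1\<close>.\<close>

definition path_vertex :: "nat \<Rightarrow> bool list \<Rightarrow> bool list \<Rightarrow> nat \<Rightarrow> bool list \<times> bool list" where
  "path_vertex k w w' j = (drop (k - j div 2) w', drop (Suc j div 2) w)"

definition path_set :: "nat \<Rightarrow> bool list \<times> bool list \<Rightarrow> (bool list \<times> bool list) set" where
  "path_set k q = path_vertex k (fst q) (snd q) ` {..2 * k}"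

lemma finite_words: "finite (words k)" and card_words: "card (words k) = 2 ^ k"
proof -
  have *: "words k = {w. set w \<subseteq> UNIV \<and> length w = k}" by (simp add: words_def)
  show "finite (words k)" unfolding * by (rule finite_lists_length_eq) simp
  show "card (words k) = 2 ^ k" unfolding * by (subst card_lists_length_eq) auto
qed

lemma finite_butterfly: "finite (butterfly k)"
proof -
  have "finite {w :: bool list. set w \<subseteq> UNIV \<and> length w \<le> k}"
    by (rule finite_lists_length_le) simp
  then have "finite ({w :: bool list. length w \<le> k} \<times> {w :: bool list. length w \<le> k})" by simp
  then show ?thesis by (rule rev_finite_subset) (auto simp: butterfly_def)
qed

lemma power_le_card_butterfly: "2 ^ k \<le> card (butterfly k)"
proof -
  have "card (Pair ([] :: bool list) ` words k) \<le> card (butterfly k)"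
    by (rule card_mono[OF finite_butterfly]) (auto simp: butterfly_def words_def)
  then show ?thesis by (simp add: card_image inj_on_def card_words)
qed

lemma path_vertex_adj:
  assumes "w \<in> words k" "w' \<in> words k" "j < 2 * k"
  shows "product_adj tree_adj tree_adj (path_vertex k w w' j) (path_vertex k w w' (Suc j))"
proof (cases "even j")
  case True
  then obtain i where i: "j = 2 * i" by blast
  then have "drop i w = w ! i # drop (Suc i) w"
    using assms by (simp add: Cons_nth_drop_Suc words_def)
  then show ?thesis
    unfolding path_vertex_def product_adj_def tree_adj_def i by auto
next
  case False
  then obtain i where i: "j = 2 * i + 1" using oddE by blast
  have "drop (k - Suc i) w' = w' ! (k - Suc i) # drop (Suc (k - Suc i)) w'"
    using assms i by (intro Cons_nth_drop_Suc[symmetric]) (simp add: words_def)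
  moreover have "Suc (k - Suc i) = k - i" using assms i by simp
  ultimately show ?thesis
    unfolding path_vertex_def product_adj_def tree_adj_def i by auto
qed

lemma card_path_set: "card (path_set k q) \<le> 2 * k + 1"
  unfolding path_set_def using card_image_le[of "{..2 * k}"] by simp

lemma card_words_suffix:
  assumes "length v \<le> k"
  shows "card {w \<in> words k. \<exists>z. w = z @ v} = 2 ^ (k - length v)"
proof -
  have "{w \<in> words k. \<exists>z. w = z @ v} = (\<lambda>z. z @ v) ` words (k - length v)"
    using assms unfolding words_def by auto
  then show ?thesis by (simp add: card_image inj_on_def card_words)
qed

text \<open>The conditions on the two end words are independent, so counting paths through a vertex
  becomes a product of two suffix counts.\<close>

lemma paths_through:
  assumes "(u, v) \<in> butterfly k"
  shows "{q \<in> words k \<times> words k. (u, v) \<in> path_set k q} =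
    {w \<in> words k. \<exists>z. w = z @ v} \<times> {w \<in> words k. \<exists>z. w = z @ u}" (is "?P = ?A \<times> ?B")
proof (intro equalityI subsetI)
  fix q assume "q \<in> ?P"
  then obtain w w' j where q: "q = (w, w')" "w \<in> words k" "w' \<in> words k"
    and "(u, v) = path_vertex k w w' j"
    unfolding path_set_def by auto
  then have "u = drop (k - j div 2) w'" "v = drop (Suc j div 2) w"
    unfolding path_vertex_def by auto
  then have "w' = take (k - j div 2) w' @ u" "w = take (Suc j div 2) w @ v" by auto
  then show "q \<in> ?A \<times> ?B" unfolding q using q by blast
next
  fix q assume "q \<in> ?A \<times> ?B"
  then obtain z z' where q: "q = (z @ v, z' @ u)" "z @ v \<in> words k" "z' @ u \<in> words k" by auto
  \<comment> \<open>At \<open>(u, v)\<close>, \<open>length u\<close> letters have been prepended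
    and \<open>k - length v\<close> dropped; lying in the network makes these counts equal or the
    second one larger by 1.\<close>
  define j where "j = length u + (k - length v)"
  have l: "length z = k - length v" "length z' = k - length u"
    "length u \<le> k" "length v \<le> k" using q by (auto simp: words_def)
  have "j = 2 * length u \<and> k - length v = length u \<or>
        j = Suc (2 * length u) \<and> k - length v = Suc (length u)"
    using assms l unfolding j_def butterfly_def by auto
  then have "path_vertex k (z @ v) (z' @ u) j = (u, v)" "j \<le> 2 * k"
    using l unfolding path_vertex_def by auto
  then show "q \<in> ?P" using q unfolding path_set_def by force
qed

text \<open>The exponent is \<open>2 * k\<close> minus the depth sum, and the depth sum is
  \<open>k\<close> or \<open>k - 1\<close>.\<close>

lemma card_paths_through:
  assumes "x \<in> butterfly k"
  shows "2 ^ k \<le> card {q \<in> words k \<times> words k. x \<in> path_set k q}"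
    and "card {q \<in> words k \<times> words k. x \<in> path_set k q} \<le> 2 ^ Suc k"
proof -
  obtain u v where x: "x = (u, v)" by fastforce
  have l: "length u \<le> k" "length v \<le> k" using assms unfolding x butterfly_def by auto
  have "card {q \<in> words k \<times> words k. x \<in> path_set k q} = 2 ^ (k - length v) * 2 ^ (k - length u)"
    using paths_through[of u v k] assms card_words_suffix l
    unfolding x by (simp add: card_cartesian_product)
  also have "\<dots> = 2 ^ (k - length v + (k - length u))" by (simp add: power_add)
  finally have c: "card {q \<in> words k \<times> words k. x \<in> path_set k q} =
    2 ^ (k - length v + (k - length u))" .
  show "2 ^ k \<le> card {q \<in> words k \<times> words k. x \<in> path_set k q}"
    unfolding c using assms l by (intro power_increasing) (auto simp: x butterfly_def)
  show "card {q \<in> words k \<times> words k. x \<in> path_set k q} \<le> 2 ^ Suc k"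
    unfolding c using assms l by (intro power_increasing) (auto simp: x butterfly_def)
qed

section \<open>Connectivity of the network after deletions\<close>

lemma path_set_subset_butterfly:
  assumes "q \<in> words k \<times> words k"
  shows "path_set k q \<subseteq> butterfly k"
proof
  fix x assume "x \<in> path_set k q"
  then obtain j where "j \<le> 2 * k" "x = path_vertex k (fst q) (snd q) j"
    unfolding path_set_def by auto
  then show "x \<in> butterfly k"
    using assms unfolding path_vertex_def butterfly_def words_def by auto
qed

lemma path_set_connected:
  assumes q: "q \<in> words k \<times> words k" and "path_set k q \<subseteq> Y"
    and "x \<in> path_set k q" "y \<in> path_set k q"
  shows "(\<lambda>u v. u \<in> Y \<and> v \<in> Y \<and> product_adj tree_adj tree_adj u v)\<^sup>*\<^sup>* x y"
    (is "?R\<^sup>*\<^sup>* x y")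
proof -
  define p where "p = path_vertex k (fst q) (snd q)"
  have "symp ?R" using product_adj_sym by (auto intro!: sympI)
  then have "symp ?R\<^sup>*\<^sup>*" by (rule symp_rtranclp)
  then have sym: "?R\<^sup>*\<^sup>* b a" if "?R\<^sup>*\<^sup>* a b" for a b using that by (rule sympD)
  have from0: "?R\<^sup>*\<^sup>* (p 0) (p j)" if "j \<le> 2 * k" for j
    using that
  proof (induction j)
    case (Suc j)
    have "p j \<in> Y" "p (Suc j) \<in> Y" using Suc.prems assms(2) unfolding path_set_def p_def by auto
    then have "?R (p j) (p (Suc j))"
      using path_vertex_adj[of "fst q" k "snd q" j] q Suc.prems unfolding p_def by auto
    moreover have "?R\<^sup>*\<^sup>* (p 0) (p j)" using Suc by simp
    ultimately show ?case by (rule rtranclp.rtrancl_into_rtrancl[rotated])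
  qed simp
  obtain i j where "i \<le> 2 * k" "x = p i" "j \<le> 2 * k" "y = p j"
    using assms(3,4) unfolding path_set_def p_def by auto
  then have "?R\<^sup>*\<^sup>* x (p 0)" "?R\<^sup>*\<^sup>* (p 0) y" using from0 sym by auto
  then show ?thesis by (rule rtranclp_trans)
qed

text \<open>
  Few of the \<open>4 ^ k\<close> paths meet \<open>C\<close>, so some \<open>w0\<close> still reaches most of the ends \<open>(w', [])\<close>, and
  through these ends every other intact path leading to them. A vertex outside the component of
  \<open>([], w0)\<close> only lies on the few remaining paths.
\<close>

lemma butterfly_component:
  assumes "finite C" "butterfly k \<subseteq> S"
  shows "\<exists>x. card (butterfly k - {y \<in> S - C. (\<lambda>u v. u \<in> S - C \<and> v \<in> S - C \<and>
      product_adj tree_adj tree_adj u v)\<^sup>*\<^sup>* x y}) \<le> (8 * k + 4) * card C"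
proof -
  let ?R = "\<lambda>u v. u \<in> S - C \<and> v \<in> S - C \<and> product_adj tree_adj tree_adj u v"
  define W where "W = words k"
  have W: "finite W" "card W = 2 ^ k" "W \<noteq> {}"
    using finite_words card_words[of k] card_gt_0_iff[of "words k"] unfolding W_def by auto
  define B where "B = {q \<in> W \<times> W. path_set k q \<inter> C \<noteq> {}}"
  have finB: "finite B" using W(1) unfolding B_def by simp
  have "B \<subseteq> (\<Union>x\<in>C \<inter> butterfly k. {q \<in> W \<times> W. x \<in> path_set k q})"
  proof
    fix q assume "q \<in> B"
    then obtain x where "q \<in> W \<times> W" "x \<in> path_set k q" "x \<in> C" unfolding B_def by blast
    then show "q \<in> (\<Union>x\<in>C \<inter> butterfly k. {q \<in> W \<times> W. x \<in> path_set k q})"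
      using path_set_subset_butterfly[of q k] unfolding W_def by blast
  qed
  then have "card B \<le> card (\<Union>x\<in>C \<inter> butterfly k. {q \<in> W \<times> W. x \<in> path_set k q})"
    using W(1) assms(1) by (intro card_mono) auto
  also have "\<dots> \<le> (\<Sum>x\<in>C \<inter> butterfly k. card {q \<in> W \<times> W. x \<in> path_set k q})"
    using assms(1) by (intro card_UN_le) auto
  also have "\<dots> \<le> card (C \<inter> butterfly k) * 2 ^ Suc k"
    using sum_bounded_above[of "C \<inter> butterfly k" "\<lambda>x. card {q \<in> W \<times> W. x \<in> path_set k q}"]
      card_paths_through(2) unfolding W_def by auto
  also have "\<dots> \<le> card C * 2 ^ Suc k"
    using assms(1) by (intro mult_right_mono card_mono) auto
  finally have cardB: "card B \<le> card C * 2 ^ Suc k" .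
  have "B = Sigma W (\<lambda>w. {w' \<in> W. (w, w') \<in> B})" unfolding B_def by auto
  then have "card B = (\<Sum>w\<in>W. card {w' \<in> W. (w, w') \<in> B})"
    using W(1) card_SigmaI[of W "\<lambda>w. {w' \<in> W. (w, w') \<in> B}"] by auto
  then obtain w0 where w0: "w0 \<in> W" "2 ^ k * card {w' \<in> W. (w0, w') \<in> B} \<le> card B"
    using exists_le_average[OF W(1,3), of "\<lambda>w. card {w' \<in> W. (w, w') \<in> B}"] W(2) by auto
  \<comment> \<open>Besides the broken paths, this discards all paths to ends that \<open>w0\<close>
    cannot reach intact. By the choice of \<open>w0\<close> at most \<open>card B\<close> pairs are
    added.\<close>
  define B' where "B' = B \<union> W \<times> {w' \<in> W. (w0, w') \<in> B}"
  have finB': "finite B'" using finB W(1) unfolding B'_def by simp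
  have "card B' \<le> card B + card (W \<times> {w' \<in> W. (w0, w') \<in> B})"
    unfolding B'_def by (rule card_Un_le)
  also have "\<dots> \<le> 2 * card B" using w0(2) W(2) by (simp add: card_cartesian_product)
  finally have cardB': "card B' \<le> 4 * card C * 2 ^ k" using cardB by simp
  \<comment> \<open>The second \<open>w0\<close> is a dummy: position 0 is \<open>([], w0)\<close>
    for every end word of length \<open>k\<close>.\<close>
  define x where "x = path_vertex k w0 w0 0"
  define K where "K = {y \<in> S - C. ?R\<^sup>*\<^sup>* x y}"
  have good: "path_set k q \<subseteq> K" if "q \<in> W \<times> W" "q \<notin> B'" for q
  proof -
    obtain w w' where q: "q = (w, w')" "w \<in> W" "w' \<in> W" using \<open>q \<in> W \<times> W\<close> by auto
    have nB: "(w, w') \<notin> B" "(w0, w') \<notin> B" using that q unfolding B'_def by auto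
    \<comment> \<open>This is \<open>(w', [])\<close>, where the paths from \<open>w\<close> and
      from \<open>w0\<close> meet.\<close>
    define t where "t = path_vertex k w w' (2 * k)"
    have x: "x \<in> path_set k (w0, w')"
      using w0(1) q unfolding x_def path_set_def W_def
      by (intro image_eqI[of _ _ 0]) (auto simp: path_vertex_def words_def)
    have t0: "t \<in> path_set k (w0, w')"
      using w0(1) q unfolding t_def path_set_def W_def
      by (intro image_eqI[of _ _ "2 * k"]) (auto simp: path_vertex_def words_def)
    have t: "t \<in> path_set k (w, w')" unfolding t_def path_set_def by auto
    have sub: "path_set k (w, w') \<subseteq> S - C" "path_set k (w0, w') \<subseteq> S - C"
      using nB q w0(1) path_set_subset_butterfly[of _ k] assms(2) unfolding B_def W_def by blast+
    have "?R\<^sup>*\<^sup>* x t"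
      using path_set_connected[OF _ sub(2) x t0] q(3) w0(1) unfolding W_def by blast
    moreover have "?R\<^sup>*\<^sup>* t y" if "y \<in> path_set k (w, w')" for y
      using path_set_connected[OF _ sub(1) t that] q unfolding W_def by blast
    ultimately have "?R\<^sup>*\<^sup>* x y" if "y \<in> path_set k (w, w')" for y
      using that rtranclp_trans[of ?R x t y] by blast
    then show ?thesis using sub(1) unfolding K_def q(1) by blast
  qed
  let ?D = "butterfly k - K"
  have finD: "finite ?D" using finite_butterfly by simp
  \<comment> \<open>Double count incidences between \<open>?D\<close> and paths: each vertex is on
    at least \<open>2 ^ k\<close> paths, all in \<open>B'\<close> by \<open>good\<close>, and a path
    has at most \<open>2 * k + 1\<close> vertices.\<close>
  have "card ?D * 2 ^ k \<le> (\<Sum>y\<in>?D. card {q \<in> W \<times> W. y \<in> path_set k q})"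
    using sum_bounded_below[of ?D "2 ^ k" "\<lambda>y. card {q \<in> W \<times> W. y \<in> path_set k q}"]
      card_paths_through(1) unfolding W_def by auto
  also have "\<dots> \<le> (\<Sum>y\<in>?D. card {q \<in> B'. y \<in> path_set k q})"
    using finB' good by (intro sum_mono card_mono) auto
  also have "\<dots> = (\<Sum>q\<in>B'. card {y \<in> ?D. y \<in> path_set k q})"
    by (rule sum_multicount_gen[OF finD finB']) simp
  also have "\<dots> \<le> (\<Sum>q\<in>B'. 2 * k + 1)"
  proof (rule sum_mono)
    fix q
    have "card {y \<in> ?D. y \<in> path_set k q} \<le> card (path_set k q)"
      by (rule card_mono) (auto simp: path_set_def)
    then show "card {y \<in> ?D. y \<in> path_set k q} \<le> 2 * k + 1" using card_path_set[of k q] by linarith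
  qed
  also have "\<dots> = card B' * (2 * k + 1)" by simp
  also have "\<dots> \<le> (4 * card C * 2 ^ k) * (2 * k + 1)" using cardB' by (rule mult_right_mono) simp
  also have "\<dots> = ((8 * k + 4) * card C) * 2 ^ k" by (simp add: algebra_simps)
  finally have "card ?D \<le> (8 * k + 4) * card C" by simp
  then show ?thesis unfolding K_def by blast
qed

text \<open>The component \<open>K\<close> has at most half of \<open>S\<close>. What
  \<open>S\<close> has outside \<open>K\<close> lies in \<open>C\<close>, in the missed network part
  \<open>?D\<close>, or among the at most four children per vertex of \<open>?D\<close>, whence the
  constant \<open>5 * (8 * k + 4) + 1\<close>.\<close>

lemma card_le_separator:
  assumes "finite S" "butterfly k \<subseteq> S" "S \<subseteq> butterfly k \<union> butterfly (Suc k)"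
    and sep: "separates (product_adj tree_adj tree_adj) S C"
  shows "card S \<le> 2 * (40 * k + 21) * card C"
proof -
  let ?R = "\<lambda>u v. u \<in> S - C \<and> v \<in> S - C \<and> product_adj tree_adj tree_adj u v"
  have CS: "C \<subseteq> S" using sep unfolding separates_def by simp
  then have finC: "finite C" using assms(1) finite_subset by blast
  obtain x where x: "card (butterfly k - {y \<in> S - C. ?R\<^sup>*\<^sup>* x y}) \<le> (8 * k + 4) * card C"
    using butterfly_component[OF finC assms(2)] by blast
  define K where "K = {y \<in> S - C. ?R\<^sup>*\<^sup>* x y}"
  have K: "2 * card K \<le> card S"
  proof (cases "x \<in> S - C")
    case True
    then have "K \<in> connected_components (product_adj tree_adj tree_adj) (S - C)"
      unfolding K_def by (rule connected_componentsI)
    then show ?thesis using sep unfolding separates_def by fastforce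
  next
    case False
    \<comment> \<open>From an \<open>x\<close> outside \<open>S - C\<close> only \<open>x\<close>
      itself is reachable, and \<open>K\<close> excludes it.\<close>
    then have "K = {}" unfolding K_def by (auto elim: converse_rtranclpE)
    then show ?thesis by simp
  qed
  let ?D = "butterfly k - K"
  define E where "E = (\<lambda>((u, v), b). (b # u, v)) ` (?D \<times> UNIV) \<union> (\<lambda>((u, v), b). (u, b # v)) ` (?D \<times> UNIV)"
  have finD: "finite ?D" using finite_butterfly by simp
  have "card E \<le> card ((\<lambda>((u, v), b). (b # u, v)) ` (?D \<times> (UNIV :: bool set))) +
      card ((\<lambda>((u, v), b). (u, b # v)) ` (?D \<times> (UNIV :: bool set)))"
    unfolding E_def by (rule card_Un_le)
  also have "\<dots> \<le> card (?D \<times> (UNIV :: bool set)) + card (?D \<times> (UNIV :: bool set))"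
    using finD by (intro add_mono card_image_le) auto
  finally have cE: "card E \<le> 4 * card ?D" by (simp add: card_cartesian_product)
  have inK: "z \<in> K" if "y \<in> K" "z \<in> S - C" "product_adj tree_adj tree_adj y z" for y z
  proof -
    have "?R y z" "?R\<^sup>*\<^sup>* x y" using that unfolding K_def by auto
    then have "?R\<^sup>*\<^sup>* x z" by (rule rtranclp.rtrancl_into_rtrancl[rotated])
    then show ?thesis using that(2) unfolding K_def by blast
  qed
  have "S - K \<subseteq> C \<union> (?D \<union> E)"
  proof
    fix z assume z: "z \<in> S - K"
    show "z \<in> C \<union> (?D \<union> E)"
    proof (cases "z \<in> C \<or> z \<in> butterfly k")
      case False
      obtain u v where uv: "z = (u, v)" by fastforce
      have len: "length u + length v = Suc k"
        using False z assms(3) unfolding uv butterfly_def by auto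
      show ?thesis
      proof (cases u)
        case Nil
        then obtain b v' where v: "v = b # v'" using len by (cases v) auto
        have "(u, v') \<in> butterfly k" using len v unfolding butterfly_def by auto
        moreover have "product_adj tree_adj tree_adj (u, v') z"
          unfolding uv v product_adj_def tree_adj_def by auto
        ultimately have "(u, v') \<in> ?D" using inK z False by blast
        then have "z \<in> E" unfolding E_def uv v by force
        then show ?thesis by blast
      next
        case (Cons b u')
        have "(u', v) \<in> butterfly k" using len Cons unfolding butterfly_def by auto
        moreover have "product_adj tree_adj tree_adj (u', v) z"
          unfolding uv Cons product_adj_def tree_adj_def by auto
        ultimately have "(u', v) \<in> ?D" using inK z False by blast
        then have "z \<in> E"
            unfolding E_def uv Cons by (intro UnI1 image_eqI[of _ _ "((u', v), b)"]) auto
        then show ?thesis by blast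
      qed
    qed (use z in auto)
  qed
  then have "card (S - K) \<le> card (C \<union> (?D \<union> E))"
    using finC finD unfolding E_def by (intro card_mono) auto
  also have "\<dots> \<le> card C + (card ?D + card E)"
    by (meson add_mono card_Un_le le_refl le_trans)
  also have "\<dots> \<le> card C + 5 * ((8 * k + 4) * card C)"
    using cE x unfolding K_def by linarith
  also have "\<dots> = (40 * k + 21) * card C" by (simp add: algebra_simps)
  finally have "card (S - K) \<le> (40 * k + 21) * card C" .
  moreover have "card S = card K + card (S - K)"
    using assms(1) card_Diff_subset[of K S] card_mono[of S K] finite_subset[of K S]
    unfolding K_def by fastforce
  ultimately show ?thesis using K by linarith
qed

section \<open>Lower bound for every size\<close>

lemma sep_product_tree_ge:
  assumes "2 \<le> n"
  shows "(1 / 244) * (real n / ln (real n)) \<le> real (sep (product_adj tree_adj tree_adj) n)"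
proof -
  have "butterfly 0 = {([], [])}" unfolding butterfly_def by auto
  then have "card (butterfly 0) \<le> n" using assms by simp
  moreover have bound: "\<forall>k. card (butterfly k) \<le> n \<longrightarrow> k \<le> n"
    using power_le_card_butterfly less_exp by (meson le_trans less_imp_le)
  ultimately obtain k where k: "card (butterfly k) \<le> n"
    and max: "\<And>i. card (butterfly i) \<le> n \<Longrightarrow> i \<le> k"
    using GreatestI_nat[of "\<lambda>k. card (butterfly k) \<le> n" 0 n]
      Greatest_le_nat[of "\<lambda>k. card (butterfly k) \<le> n" _ n] by blast
  \<comment> \<open>Maximality of \<open>k\<close> leaves enough room in the next network to fill
    \<open>S\<close> up to exactly \<open>n\<close> vertices.\<close>
  have "n \<le> card (butterfly (Suc k))" using max[of "Suc k"] by fastforce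
  also have "\<dots> \<le> card (butterfly k \<union> butterfly (Suc k))"
    using finite_butterfly by (intro card_mono) auto
  finally obtain S where S: "butterfly k \<subseteq> S" "S \<subseteq> butterfly k \<union> butterfly (Suc k)" "card S = n"
    using exists_subset_between[OF k _ _ , of "butterfly k \<union> butterfly (Suc k)"]
      finite_butterfly by blast
  have finS: "finite S" using S(2) finite_butterfly finite_subset by blast
  obtain C where C: "separates (product_adj tree_adj tree_adj) S C"
    "card C = cut (product_adj tree_adj tree_adj) S" by (rule cut_attained)
  have "card C \<le> sep (product_adj tree_adj tree_adj) n"
    using cut_le_sep[OF finS] C(2) S(3) by metis
  moreover have "n \<le> 2 * (40 * k + 21) * card C"
    using card_le_separator[OF finS S(1,2) C(1)] S(3) by simp
  ultimately have "n \<le> 2 * (40 * k + 21) * sep (product_adj tree_adj tree_adj) n"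
    by (meson le_trans mult_le_mono2)
  then have "real n \<le> real (2 * (40 * k + 21) * sep (product_adj tree_adj tree_adj) n)"
    by (rule of_nat_mono)
  also have "\<dots> = (80 * real k + 42) * real (sep (product_adj tree_adj tree_adj) n)" by simp
  also have "\<dots> \<le> (244 * ln (real n)) * real (sep (product_adj tree_adj tree_adj) n)"
  proof (rule mult_right_mono)
    \<comment> \<open>Both \<open>k\<close> and 1 are at most \<open>2 * ln n\<close>, so 244 arises
      as \<open>2 * (80 + 42)\<close>.\<close>
    have ln2: "1 / 2 \<le> ln (2 :: real)" using ln_le_minus_one[of "1 / 2 :: real"] by (simp add: ln_div)
    have "2 ^ k \<le> n" using power_le_card_butterfly[of k] k by linarith
    then have "(2 :: real) ^ k \<le> real n" by (metis of_nat_le_iff of_nat_numeral of_nat_power)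
    then have "ln ((2 :: real) ^ k) \<le> ln (real n)" using assms by (subst ln_le_cancel_iff) auto
    then have "real k * ln 2 \<le> ln (real n)" by (simp add: ln_realpow)
    moreover have "real k * (1 / 2) \<le> real k * ln 2" using ln2 by (intro mult_left_mono) auto
    moreover have "ln 2 \<le> ln (real n)" using assms by (subst ln_le_cancel_iff) auto
    ultimately show "80 * real k + 42 \<le> 244 * ln (real n)" using ln2 by linarith
  qed simp
  finally show ?thesis using assms by (simp add: field_simps)
qed

theorem theorem3p5:
  "\<exists>c C :: real. 0 < c \<and> c \<le> C \<and>
     (\<forall>n::nat. 2 \<le> n \<longrightarrow>
        c * (real n / ln (real n)) \<le> real (sep (product_adj tree_adj tree_adj) n) \<and>
        real (sep (product_adj tree_adj tree_adj) n) \<le> C * (real n / ln (real n)))"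
  using sep_product_tree_ge sep_product_tree_le
  by (intro exI[of _ "1 / 244"] exI[of _ 16]) auto

end
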